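(* Let $\vec{c} = \nabla_{\vec{x}_t} \log p(\vec{y} \mid \vec{x}_t) \in \mathbb{R}^d$ and let $\mathbf{E}_t = [\vec{\epsilon}_t^1, \ldots, \vec{\epsilon}_t^K] \in \mathbb{R}^{d \times K}$ be the matrix whose columns are the codebook noise vectors $\vec{\epsilon}_t^1,\ldots,\vec{\epsilon}_t^K \in \mathbb{R}^d$. Then the optimal weight vector $\vec{\gamma}^* \in \mathbb{R}^K$ solving $$\vec{\gamma}^* = \operatorname*{argmax}_{\vec{\gamma} \in \mathbb{R}^K,\ \|\vec{\gamma}\|_2 = 1} \left\langle \nabla_{\vec{x}_t} \log p(\vec{y} \mid \vec{x}_t),\ \sum_{i=1}^K \gamma_i \vec{\epsilon}^i_{t} \right\rangle$$ is given by $$\vec{\gamma}^* = \frac{ \mathbf{E}_t^\top \vec{c} }{ \| \mathbf{E}_t^\top \vec{c} \|_2 }.$$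
   Context: Here $\langle\cdot,\cdot\rangle$ and $\|\cdot\|_2$ are the standard Euclidean inner product and norm, and $\vec{\gamma} = (\gamma_1,\ldots,\gamma_K)$. The vector $\nabla_{\vec{x}_t}\log p(\vec{y}\mid\vec{x}_t)$ (the measurement score) is the gradient in $\vec{x}_t\in\mathbb{R}^d$ of the log-likelihood of an observation $\vec{y}$ given the state $\vec{x}_t$ of a diffusion model at time step $t$; it enters the claim only as a given vector $\vec{c}$ of $\mathbb{R}^d$. The vectors $\vec{\epsilon}_t^1,\ldots,\vec{\epsilon}_t^K$ are Gaussian vectors drawn from a fixed noise codebook of size $K$. *)

theory Defs
  imports "HOL-Analysis.Analysis"
begin

end

theory Submission
  imports Defs
begin

text \<open>Moving the matrix across the inner product turns the objective into
  \<open>\<gamma> \<mapsto> (E\<^sup>T c) \<bullet> \<gamma>\<close>, which Cauchy--Schwarz bounds on the unit sphere by \<open>norm (E\<^sup>T c)\<close>;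
  the equality case identifies the unique maximiser.\<close>

text \<open>For \<open>v = 0\<close> every unit vector is a maximiser, while
  \<open>v /\<^sub>R norm v\<close> is the zero vector; hence the hypothesis.\<close>

lemma is_arg_max_inner_unit_sphere:
  fixes v x :: "'a :: real_inner"
  assumes "v \<noteq> 0"
  shows "is_arg_max (\<lambda>x. v \<bullet> x) (\<lambda>x. norm x = 1) x \<longleftrightarrow> x = v /\<^sub>R norm v"
proof -
  let ?u = "v /\<^sub>R norm v"
  have norm_u: "norm ?u = 1"
    using assms by simp
  have inner_u: "v \<bullet> ?u = norm v"
    using assms by (simp add: dot_square_norm power2_eq_square)
  have bound: "v \<bullet> y \<le> norm v" if "norm y = 1" for y
    using norm_cauchy_schwarz[of v y] that by simp
  have eq: "v \<bullet> y = norm v \<longleftrightarrow> y = ?u" if "norm y = 1" for y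
  proof
    assume "v \<bullet> y = norm v"
    \<comment> \<open>Equality in Cauchy--Schwarz forces
      \<open>norm v *\<^sub>R y = norm y *\<^sub>R v\<close>, and \<open>norm y = 1\<close>.\<close>
    then have "norm v *\<^sub>R y = v"
      using norm_cauchy_schwarz_eq[of v y] that by simp
    then have "?u = (norm v *\<^sub>R y) /\<^sub>R norm v"
      by simp
    then show "y = ?u"
      using assms by simp
  next
    assume "y = ?u"
    then show "v \<bullet> y = norm v"
      using inner_u by simp
  qed
  show ?thesis
    unfolding is_arg_max_linorder
    \<comment> \<open>A maximiser does at least as well as \<open>?u\<close>, so it attains the
      bound and \<open>eq\<close> applies.\<close>
    using norm_u inner_u bound eq by (metis order_antisym)
qed

text \<open>The combination of columns is \<open>A *v x\<close>, and the transpose is the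
  adjoint.\<close>

lemma inner_sum_columns:
  fixes A :: "real ^ 'n ^ 'm"
  shows "c \<bullet> (\<Sum>i\<in>UNIV. (x $ i) *\<^sub>R column i A) = (transpose A *v c) \<bullet> x"
  unfolding transpose_matrix_vector dot_lmul_matrix
  by (simp add: matrix_mult_sum scalar_mult_eq_scaleR)

theorem theorem3p2:
  fixes c :: "real ^ 'd"
    and eps :: "'k::finite \<Rightarrow> real ^ 'd"
    and E :: "real ^ 'k ^ 'd"
    and \<gamma> :: "real ^ 'k"
  assumes columns: "\<And>i. column i E = eps i"
    and nonzero: "transpose E *v c \<noteq> 0"
  shows "is_arg_max (\<lambda>\<gamma>. c \<bullet> (\<Sum>i\<in>UNIV. (\<gamma> $ i) *\<^sub>R eps i)) (\<lambda>\<gamma>. norm \<gamma> = 1) \<gamma>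
    \<longleftrightarrow> \<gamma> = (transpose E *v c) /\<^sub>R norm (transpose E *v c)"
  unfolding columns[symmetric] inner_sum_columns
  using nonzero by (rule is_arg_max_inner_unit_sphere)

end
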